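(* Let $2\le k\le r$ be integers and let $\alpha$ be a real number with $k-1<\alpha\le r$. Then for every $n\ge r$ there exists an ordered $n$-vertex $r$-graph $H(n,r)$ with $d\,n^{\alpha}$ edges (where $d$ may depend on $n$) such that for every interval $k$-partite subgraph $H'$ of $H(n,r)$ with parts of size $m$ and $e(H')=\Omega(d\,m^{\alpha})$, $$m=O(n^{1-1/\alpha}).$$
   Context: An $r$-graph is a finite hypergraph all of whose edges have size $r$; $e(H)$ is the number of edges of $H$. An ordered $r$-graph is an $r$-graph with a linear ordering of its vertex set $V$. An interval in $V$ is a set of consecutive elements in the ordering; $A<B$ means $a<b$ for all $a\in A$, $b\in B$. An ordered $r$-graph $H$ is interval $k$-partite if for some $\ell\ge k$ there are intervals $I_1<I_2<\cdots<I_\ell$ (the parts) of the vertex set such that every edge of $H$ is contained in $I_1\cup\dots\cup I_\ell$ and has nonempty intersection with $I_j$ for each $1\le j\le \ell$. The asymptotic notation means: for every $c>0$ there is a constant $C$ depending only on $c,r,k,\alpha$ such that $e(H')\ge c\,d\,m^{\alpha}$ implies $m\le C\,n^{1-1/\alpha}$. *)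

theory Defs
  imports Complex_Main
begin

text \<open>The linear ordering of the vertex set is the one inherited from the vertex type.\<close>

definition ordered_rgraph :: "nat \<Rightarrow> 'a::linorder set \<Rightarrow> 'a set set \<Rightarrow> bool" where
  "ordered_rgraph r V E \<longleftrightarrow> finite V \<and> (\<forall>e\<in>E. e \<subseteq> V \<and> card e = r)"

definition subgraph :: "'a set \<Rightarrow> 'a set set \<Rightarrow> 'a set \<Rightarrow> 'a set set \<Rightarrow> bool" where
  "subgraph V' E' V E \<longleftrightarrow> V' \<subseteq> V \<and> E' \<subseteq> E \<and> (\<forall>e\<in>E'. e \<subseteq> V')"

definition interval_in :: "'a::linorder set \<Rightarrow> 'a set \<Rightarrow> bool" where
  "interval_in V A \<longleftrightarrow> A \<subseteq> V \<and> (\<forall>x\<in>A. \<forall>y\<in>A. \<forall>z\<in>V. x \<le> z \<and> z \<le> y \<longrightarrow> z \<in> A)"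

definition set_before :: "'a::linorder set \<Rightarrow> 'a set \<Rightarrow> bool" where
  "set_before A B \<longleftrightarrow> (\<forall>a\<in>A. \<forall>b\<in>B. a < b)"

definition interval_parts :: "'a::linorder set \<Rightarrow> 'a set set \<Rightarrow> 'a set list \<Rightarrow> bool" where
  "interval_parts V E Is \<longleftrightarrow>
     (\<forall>A\<in>set Is. interval_in V A) \<and>
     sorted_wrt set_before Is \<and>
     (\<forall>e\<in>E. e \<subseteq> \<Union>(set Is) \<and> (\<forall>A\<in>set Is. e \<inter> A \<noteq> {}))"

text \<open>Interval \<open>k\<close>-partite with all parts of size \<open>m\<close>; the number of parts may exceed \<open>k\<close>.\<close>

definition interval_k_partite_size ::
    "nat \<Rightarrow> nat \<Rightarrow> 'a::linorder set \<Rightarrow> 'a set set \<Rightarrow> bool" where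
  "interval_k_partite_size k m V E \<longleftrightarrow>
     (\<exists>Is. k \<le> length Is \<and> interval_parts V E Is \<and> (\<forall>A\<in>set Is. card A = m))"

end

theory Submission
  imports Defs
begin

text \<open>
  Take for the edges \<open>\<lfloor>n / r\<rfloor>\<close> disjoint blocks of \<open>r\<close> consecutive vertices. If two blocks
  \<open>e < f\<close> both met each of two parts \<open>A < B\<close>, a point of \<open>e \<inter> B\<close> would lie before a point
  of \<open>f \<inter> A\<close>, which is absurd. Hence an interval 2-partite subgraph has at most one edge, so
  \<open>c d m\<^sup>\<alpha> \<le> 1\<close> with \<open>d \<ge> n\<^bsup>1-\<alpha>\<^esup> / (2 r)\<close>, which bounds \<open>m\<close> by a multiple of
  \<open>n\<^bsup>1-1/\<alpha>\<^esup>\<close>.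
\<close>

definition block :: "nat \<Rightarrow> nat \<Rightarrow> nat set" where
  "block r i = {r * i..<r * Suc i}"

lemma card_block [simp]: "card (block r i) = r"
  by (simp add: block_def)

lemma set_before_block:
  assumes "i < j"
  shows "set_before (block r i) (block r j)"
proof -
  have "r * Suc i \<le> r * j"
    using assms by (intro mult_le_mono2) simp
  then show ?thesis
    by (auto simp: set_before_def block_def)
qed

lemma inj_block:
  assumes "0 < r"
  shows "inj (block r)"
proof (rule injI)
  fix i j
  assume "block r i = block r j"
  \<comment> \<open>A block is recovered from its least element; positivity of \<open>r\<close>
    makes it nonempty and lets \<open>r\<close> be cancelled.\<close>
  moreover have "Min (block r l) = r * l" for l
    using assms by (intro Min_eqI) (auto simp: block_def)
  ultimately show "i = j"
    using assms by (metis mult_left_cancel less_not_refl)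
qed

lemma block_subset:
  assumes "i < n div r"
  shows "block r i \<subseteq> {..<n}"
proof -
  have "r * Suc i \<le> r * (n div r)"
    using assms by (intro mult_le_mono2) simp
  also have "\<dots> \<le> n"
    by simp
  finally show ?thesis
    by (auto simp: block_def)
qed

lemma card_interval_partite_le_1:
  assumes chain: "\<And>e f. e \<in> E \<Longrightarrow> f \<in> E \<Longrightarrow> e \<noteq> f \<Longrightarrow> set_before e f \<or> set_before f e"
    and "interval_k_partite_size k m V E" and "2 \<le> k"
  shows "card E \<le> 1"
proof -
  obtain Is where Is: "k \<le> length Is" "interval_parts V E Is"
    using assms(2) by (auto simp: interval_k_partite_size_def)
  \<comment> \<open>Two parts already force the conflict, and \<open>2 \<le> k\<close> supplies
    them.\<close>
  then obtain A B Js where "Is = A # B # Js"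
    using \<open>2 \<le> k\<close> by (metis Suc_le_length_iff numeral_2_eq_2 order_trans)
  with Is have AB: "set_before A B" and meets: "\<And>e. e \<in> E \<Longrightarrow> e \<inter> A \<noteq> {} \<and> e \<inter> B \<noteq> {}"
    by (auto simp: interval_parts_def)
  have "\<not> set_before e f" if "e \<in> E" "f \<in> E" for e f
    using meets[OF that(1)] meets[OF that(2)] AB unfolding set_before_def
    by (meson disjoint_iff less_asym)
  then have "\<And>e f. e \<in> E \<Longrightarrow> f \<in> E \<Longrightarrow> e = f"
    using chain by blast
  then show ?thesis
    \<comment> \<open>The criterion used here is for finite sets; an infinite \<open>E\<close> would
      have \<open>card\<close> 0 by convention.\<close>
    by (metis card.infinite card_le_Suc0_iff_eq One_nat_def le0)
qed

text \<open>Solves the edge inequality for the part size \<open>y\<close> in terms of the vertex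
  number \<open>x\<close>: insert the lower bound on \<open>d\<close>, clear the power of
  \<open>x\<close>, then take the root of order \<alpha>. The factor \<open>K\<close> is the loss in
  the edge density.\<close>

lemma part_size_bound:
  fixes c d \<alpha> x y K :: real
  assumes "0 < c" "0 < \<alpha>" "0 < K" "0 < x" "0 \<le> y"
    and d: "x powr (1 - \<alpha>) / K \<le> d" and le: "c * d * y powr \<alpha> \<le> 1"
  shows "y \<le> (K / c) powr (1 / \<alpha>) * x powr (1 - 1 / \<alpha>)"
proof -
  have "c * (x powr (1 - \<alpha>) / K) * y powr \<alpha> \<le> c * d * y powr \<alpha>"
    using assms by (intro mult_right_mono mult_left_mono) auto
  with le have "c * (x powr (1 - \<alpha>) / K) * y powr \<alpha> \<le> 1"
    by linarith
  then have "x powr (1 - \<alpha>) * y powr \<alpha> \<le> K / c"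
    using assms by (simp add: field_simps)
  \<comment> \<open>The new factor is the inverse of \<open>x powr (1 - \<alpha>)\<close>, as
    \<open>x\<close> is positive.\<close>
  then have "x powr (\<alpha> - 1) * (x powr (1 - \<alpha>) * y powr \<alpha>) \<le> x powr (\<alpha> - 1) * (K / c)"
    by (intro mult_left_mono) auto
  moreover have "x powr (\<alpha> - 1) * x powr (1 - \<alpha>) = 1"
    using assms by (simp flip: powr_add)
  ultimately have "y powr \<alpha> \<le> K / c * x powr (\<alpha> - 1)"
    by (metis mult.assoc mult.commute mult_1)
  then have "(y powr \<alpha>) powr (1 / \<alpha>) \<le> (K / c * x powr (\<alpha> - 1)) powr (1 / \<alpha>)"
    using assms by (intro powr_mono2) auto
  moreover have "(y powr \<alpha>) powr (1 / \<alpha>) = y"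
    using assms by (simp add: powr_powr)
  moreover have "(\<alpha> - 1) * (1 / \<alpha>) = 1 - 1 / \<alpha>"
    using assms by (simp add: field_simps)
  ultimately show ?thesis
    using assms by (simp only: powr_mult powr_powr)
qed

theorem mainTheorem10:
  fixes k r :: nat and \<alpha> :: real
  assumes "2 \<le> k" and "k \<le> r" and "real k - 1 < \<alpha>" and "\<alpha> \<le> real r"
  shows "\<exists>C :: real \<Rightarrow> real. \<forall>n\<ge>r. \<exists>(V :: nat set) E d.
           ordered_rgraph r V E \<and> card V = n \<and> real (card E) = d * real n powr \<alpha> \<and>
           (\<forall>c V' E' m. c > 0 \<and> subgraph V' E' V E \<and> interval_k_partite_size k m V' E' \<and>
              real (card E') \<ge> c * d * real m powr \<alpha> \<longrightarrow>
              real m \<le> C c * real n powr (1 - 1 / \<alpha>))"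
\<comment> \<open>This is the constant of \<open>part_size_bound\<close> with
  \<open>K = 2 * real r\<close>; it is fixed before \<open>n\<close>.\<close>
proof (intro exI[of _ "\<lambda>c. (2 * real r / c) powr (1 / \<alpha>)"] allI impI)
  fix n
  assume "r \<le> n"
  have pos: "0 < \<alpha>" "0 < r" "0 < n"
    using assms \<open>r \<le> n\<close> by linarith+
  define E where "E = block r ` {..<n div r}"
  define d where "d = real (n div r) / real n powr \<alpha>"
  have graph: "ordered_rgraph r {..<n} E"
    using block_subset by (auto simp: ordered_rgraph_def E_def)
  have "card E = n div r"
    unfolding E_def using inj_block[OF \<open>0 < r\<close>]
    by (subst card_image) (auto intro: inj_on_subset)
  then have card_E: "real (card E) = d * real n powr \<alpha>"
    using pos by (simp add: d_def)
  \<comment> \<open>Source of the 2 in \<open>K\<close>: at least one block fits, so the remainder,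
    being below \<open>r\<close>, is at most the number of vertices covered by blocks.\<close>
  have "1 \<le> n div r"
    using \<open>r \<le> n\<close> pos by (simp add: Suc_le_eq div_greater_zero_iff)
  then have "r \<le> r * (n div r)"
    by simp
  moreover have "n = r * (n div r) + n mod r" "n mod r < r"
    using pos by simp_all
  ultimately have "n \<le> 2 * (r * (n div r))"
    by linarith
  then have "real n \<le> real (2 * (r * (n div r)))"
    by (rule of_nat_mono)
  then have "real n / (2 * real r) \<le> real (n div r)"
    using pos by (simp add: field_simps)
  then have "real n / (2 * real r) / real n powr \<alpha> \<le> d"
    unfolding d_def by (rule divide_right_mono) simp
  then have d: "real n powr (1 - \<alpha>) / (2 * real r) \<le> d"
    using pos by (simp add: powr_diff mult.commute)
  have "real m \<le> (2 * real r / c) powr (1 / \<alpha>) * real n powr (1 - 1 / \<alpha>)"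
    if "c > 0" "subgraph V' E' {..<n} E" "interval_k_partite_size k m V' E'"
      "real (card E') \<ge> c * d * real m powr \<alpha>" for c V' E' m
  proof -
    \<comment> \<open>Distinct blocks have distinct indices, and the order of the indices orders the
      blocks.\<close>
    have "set_before e f \<or> set_before f e" if "e \<in> E'" "f \<in> E'" "e \<noteq> f" for e f
    proof -
      obtain i j where "e = block r i" "f = block r j"
        using \<open>e \<in> E'\<close> \<open>f \<in> E'\<close> \<open>subgraph V' E' {..<n} E\<close> unfolding subgraph_def E_def by blast
      with \<open>e \<noteq> f\<close> show ?thesis
        using set_before_block[of i j r] set_before_block[of j i r] by (metis nat_neq_iff)
    qed
    then have "card E' \<le> 1"
      using card_interval_partite_le_1 that(3) assms(1) by blast
    then have "c * d * real m powr \<alpha> \<le> 1"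
      using that(4) by linarith
    then show ?thesis
      using part_size_bound[OF \<open>c > 0\<close> pos(1) _ _ _ d] pos by simp
  qed
  then show "\<exists>(V :: nat set) E d.
      ordered_rgraph r V E \<and> card V = n \<and> real (card E) = d * real n powr \<alpha> \<and>
      (\<forall>c V' E' m. c > 0 \<and> subgraph V' E' V E \<and> interval_k_partite_size k m V' E' \<and>
         real (card E') \<ge> c * d * real m powr \<alpha> \<longrightarrow>
         real m \<le> (2 * real r / c) powr (1 / \<alpha>) * real n powr (1 - 1 / \<alpha>))"
    using graph card_E
    by (intro exI[of _ "{..<n}"] exI[of _ E] exI[of _ d]) auto
qed

end
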